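(* Let $X$ be a cut space and let $p:X\to X$ be a continuous map that is a kernel operator with respect to the specialization preorder of $X$. Then $p(X)$, with the subspace topology from $X$, is a cut space.
   Context: For a topological space $X$, the specialization preorder is $x\le y$ iff $x\in\mathrm{cl}\{y\}$; all order-theoretic notions in $X$ refer to it (for a subspace, to the specialization preorder of the subspace, with bounds taken inside the subspace). For $A\subseteq X$, $A^{\uparrow}$ and $A^{\downarrow}$ denote the sets of all upper, respectively lower, bounds of $A$ in $X$, and $A^{\delta}=(A^{\uparrow})^{\downarrow}$ is the cut closure of $A$. Directed sets are nonempty. $X$ is a cut space if $\mathrm{cl}\,D=D^{\delta}$ for every directed subset $D$ of $X$. A kernel operator is a monotone idempotent self-map $p$ (so $p\circ p=p$) with $p(x)\le x$ for all $x$. *)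

theory Defs
  imports "HOL-Analysis.Abstract_Topology"
begin

text \<open>
  All order-theoretic notions are taken in an abstract topology \<open>X\<close>, with respect to its
  specialization preorder. For a subspace they are instantiated with \<open>subtopology X S\<close>,
  so that bounds are automatically taken inside the subspace.
\<close>

text \<open>\<open>spec_le X x y\<close> entails that \<open>x\<close> and \<open>y\<close> both lie in \<open>topspace X\<close>.\<close>

definition spec_le :: "'a topology \<Rightarrow> 'a \<Rightarrow> 'a \<Rightarrow> bool" where
  "spec_le X x y \<longleftrightarrow> x \<in> X closure_of {y}"

definition upper_bounds :: "'a topology \<Rightarrow> 'a set \<Rightarrow> 'a set" where
  "upper_bounds X A = {u \<in> topspace X. \<forall>a\<in>A. spec_le X a u}"

definition lower_bounds :: "'a topology \<Rightarrow> 'a set \<Rightarrow> 'a set" where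
  "lower_bounds X A = {l \<in> topspace X. \<forall>a\<in>A. spec_le X l a}"

text \<open>If \<open>A\<close> has no upper bound, its cut closure is the whole of \<open>topspace X\<close>.\<close>

definition cut_closure :: "'a topology \<Rightarrow> 'a set \<Rightarrow> 'a set" where
  "cut_closure X A = lower_bounds X (upper_bounds X A)"

definition directed_in :: "'a topology \<Rightarrow> 'a set \<Rightarrow> bool" where
  "directed_in X D \<longleftrightarrow> D \<subseteq> topspace X \<and> D \<noteq> {} \<and>
     (\<forall>x\<in>D. \<forall>y\<in>D. \<exists>z\<in>D. spec_le X x z \<and> spec_le X y z)"

definition cut_space :: "'a topology \<Rightarrow> bool" where
  "cut_space X \<longleftrightarrow> (\<forall>D. directed_in X D \<longrightarrow> X closure_of D = cut_closure X D)"

text \<open>Idempotency is literal equality, also when the specialization preorder is not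
  antisymmetric.\<close>

definition kernel_operator :: "'a topology \<Rightarrow> ('a \<Rightarrow> 'a) \<Rightarrow> bool" where
  "kernel_operator X p \<longleftrightarrow> p \<in> topspace X \<rightarrow> topspace X \<and>
     monotone_on (topspace X) (spec_le X) (spec_le X) p \<and>
     (\<forall>x\<in>topspace X. p (p x) = p x) \<and>
     (\<forall>x\<in>topspace X. spec_le X (p x) x)"

end

theory Submission
  imports Defs
begin

text \<open>
  Bounds transfer between \<open>X\<close> and \<open>p(X)\<close>: an upper bound \<open>u\<close> in \<open>X\<close> of a directed
  \<open>D \<subseteq> p(X)\<close> can be replaced by the smaller \<open>p u\<close>, which lies in \<open>p(X)\<close> and still bounds
  \<open>D = p(D)\<close>. Hence the cut closure of \<open>D\<close> in \<open>p(X)\<close> is the trace of its cut closure in \<open>X\<close>,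
  just as for topological closures.
\<close>

lemma spec_le_trans:
  assumes "spec_le X x y" and "spec_le X y z"
  shows "spec_le X x z"
proof -
  have "X closure_of {y} \<subseteq> X closure_of {z}"
    using assms(2) by (simp add: spec_le_def closure_of_minimal)
  then show ?thesis
    using assms(1) by (auto simp: spec_le_def)
qed

lemma spec_le_subtopology:
  "spec_le (subtopology X S) x y \<longleftrightarrow> x \<in> S \<and> y \<in> S \<and> spec_le X x y"
  \<comment> \<open>Closing \<open>{y}\<close> in the subspace amounts to closing
    \<open>S \<inter> {y}\<close> in \<open>X\<close>, which is empty for \<open>y\<close> outside
    \<open>S\<close>; hence the case split.\<close>
  by (cases "y \<in> S") (auto simp: spec_le_def closure_of_subtopology)

text \<open>Lets the cut space property of \<open>X\<close> be applied to directed sets of a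
  subspace.\<close>

lemma directed_in_subtopologyD:
  assumes "directed_in (subtopology X S) D"
  shows "directed_in X D" and "D \<subseteq> S"
proof -
  show "D \<subseteq> S"
    using assms by (auto simp: directed_in_def)
  show "directed_in X D"
    using assms unfolding directed_in_def spec_le_subtopology topspace_subtopology by blast
qed

lemma cut_closure_subtopology_kernel_image:
  assumes p: "kernel_operator X p" and D: "D \<subseteq> p ` topspace X"
  shows "cut_closure (subtopology X (p ` topspace X)) D = p ` topspace X \<inter> cut_closure X D"
    (is "cut_closure ?Y D = ?S \<inter> _")
proof -
  have S: "?S \<subseteq> topspace X"
    and fixed: "\<And>x. x \<in> ?S \<Longrightarrow> p x = x"
    and le: "\<And>x. x \<in> topspace X \<Longrightarrow> spec_le X (p x) x"
    and mono: "\<And>x y. \<lbrakk>x \<in> topspace X; y \<in> topspace X; spec_le X x y\<rbrakk> \<Longrightarrow> spec_le X (p x) (p y)"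
    using p by (auto simp: kernel_operator_def monotone_on_def)
  have upper: "upper_bounds ?Y D = ?S \<inter> upper_bounds X D"
    using D S by (auto simp: upper_bounds_def spec_le_subtopology)
  have p_upper: "p u \<in> ?S \<inter> upper_bounds X D" if u: "u \<in> upper_bounds X D" for u
  proof -
    have "spec_le X d (p u)" if "d \<in> D" for d
    proof -
      have d: "d \<in> ?S"
        using that D by blast
      with S have "spec_le X (p d) (p u)"
        using u that by (intro mono) (auto simp: upper_bounds_def)
      then show ?thesis
        using fixed[OF d] by simp
    qed
    then show ?thesis
      using u S by (auto simp: upper_bounds_def)
  qed
  have "lower_bounds ?Y (?S \<inter> upper_bounds X D) = ?S \<inter> lower_bounds X (?S \<inter> upper_bounds X D)"
    using S by (auto simp: lower_bounds_def spec_le_subtopology)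
  \<comment> \<open>Discarding the upper bounds outside \<open>?S\<close> might admit new lower
    bounds. It does not: every discarded \<open>u\<close> lies above the retained bound
    \<open>p u\<close>.\<close>
  also have "lower_bounds X (?S \<inter> upper_bounds X D) = lower_bounds X (upper_bounds X D)"
  proof
    show "lower_bounds X (?S \<inter> upper_bounds X D) \<subseteq> lower_bounds X (upper_bounds X D)"
    proof
      fix s assume s: "s \<in> lower_bounds X (?S \<inter> upper_bounds X D)"
      have "spec_le X s u" if u: "u \<in> upper_bounds X D" for u
      proof (rule spec_le_trans)
        show "spec_le X s (p u)"
          using s p_upper[OF u] by (simp add: lower_bounds_def)
        show "spec_le X (p u) u"
          using u le by (simp add: upper_bounds_def)
      qed
      then show "s \<in> lower_bounds X (upper_bounds X D)"
        using s by (simp add: lower_bounds_def)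
    qed
  \<comment> \<open>The other inclusion holds because fewer elements have more lower bounds.\<close>
  qed (auto simp: lower_bounds_def)
  finally show ?thesis
    by (simp add: cut_closure_def upper)
qed

theorem proposition3p9:
  fixes X :: "'a topology" and p :: "'a \<Rightarrow> 'a"
  assumes "cut_space X"
    and "continuous_map X X p"
    and "kernel_operator X p"
  shows "cut_space (subtopology X (p ` topspace X))"
  unfolding cut_space_def
proof (intro allI impI)
  fix D
  let ?S = "p ` topspace X"
  assume "directed_in (subtopology X ?S) D"
  then have D: "directed_in X D" "D \<subseteq> ?S"
    by (rule directed_in_subtopologyD)+
  \<comment> \<open>The general formula closes \<open>?S \<inter> D\<close> in \<open>X\<close>, and
    this set is \<open>D\<close> itself.\<close>
  have "subtopology X ?S closure_of D = ?S \<inter> X closure_of D"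
    using D(2) by (simp add: closure_of_subtopology Int_absorb1)
  also have "\<dots> = ?S \<inter> cut_closure X D"
    using assms(1) D(1) by (simp add: cut_space_def)
  also have "\<dots> = cut_closure (subtopology X ?S) D"
    using cut_closure_subtopology_kernel_image[OF assms(3) D(2)] by simp
  finally show "subtopology X ?S closure_of D = cut_closure (subtopology X ?S) D" .
qed

end
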